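(* Let $\mathcal{R}$ be a commutative ring containing $\mathbb{Q}$, let $F(x_0)\in\mathcal{R}[[x_0]]$ be a formal power series in one variable, and let $n\ge1$. Then $$(\mathcal{P}_nF)(x_0,\dots,x_n)=\sum_{k=1}^nF^{(k)}(x_0)\,B^{\mathcal{B}}_{n,k}(x_0,x_1,\dots,x_n).$$
   Context: With $\partial_i=\partial/\partial x_i$, put $\mathcal{D}_m=\sum_{i=0}^{m-1}x_{i+1}\partial_i$, $\mathcal{D}_m^*=\sum_{i=0}^{m-1}x_i\partial_{i+1}$, $\mathcal{B}_m=\mathcal{D}_m+\mathcal{D}_m^*$ and $\mathcal{P}_n=\mathcal{B}_n\mathcal{B}_{n-1}\cdots\mathcal{B}_1$ (acting on power series in $x_0,x_1,x_2,\dots$). A good ballot counting on a totally ordered finite set $V=\{v_1<\dots<v_m\}$ is a function $g:V\to\{-1,1\}$ such that $\sum_{j=1}^{l}g(v_j)\ge0$ for every $1\le l\le m$; its ballot cardinal is $\sum_{j=1}^{m}g(v_j)$. A ballot partition of $[n]=\{1,\dots,n\}$ is a set partition $\pi$ of $[n]$ together with a good ballot counting on each block (with the induced order); $|B|_b$ denotes the ballot cardinal of the ballot counting attached to the block $B$. The generalized partial Bell polynomial is $B^{\mathcal{B}}_{n,k}(\mathbf{x})=\sum\prod_{B\in\pi}x_{|B|_b}$, the sum being over all ballot partitions of $[n]$ with exactly $k$ blocks. $F^{(k)}$ denotes the $k$-th derivative. *)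

theory Defs
  imports
    "HOL-Computational_Algebra.Formal_Power_Series"
    "HOL-Library.Poly_Mapping"
    "HOL-Library.Disjoint_Sets"
    "HOL-Library.FuncSet"
begin

text \<open>
  A monomial is its finitely supported exponent vector, of type \<^typ>\<open>nat \<Rightarrow>\<^sub>0 nat\<close>; a power series
  is an arbitrary family of coefficients indexed by monomials.
\<close>

typedef 'a mps = "UNIV :: ((nat \<Rightarrow>\<^sub>0 nat) \<Rightarrow> 'a) set"
  morphisms mps_nth Abs_mps ..

setup_lifting type_definition_mps

lemma mps_eqI: "(\<And>m. mps_nth f m = mps_nth g m) \<Longrightarrow> f = g"
  by transfer auto

definition antidiag :: "(nat \<Rightarrow>\<^sub>0 nat) \<Rightarrow> ((nat \<Rightarrow>\<^sub>0 nat) \<times> (nat \<Rightarrow>\<^sub>0 nat)) set" where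
  "antidiag m = {(a, b). a + b = m}"

lemma antidiag_iff [simp]: "(a, b) \<in> antidiag m \<longleftrightarrow> a + b = m"
  by (simp add: antidiag_def)

lemma finite_antidiag [simp]: "finite (antidiag m)"
proof -
  let ?r = "\<lambda>p. restrict (Poly_Mapping.lookup (fst p)) (Poly_Mapping.keys m)"
  have "?r ` antidiag m \<subseteq> (\<Pi>\<^sub>E i\<in>Poly_Mapping.keys m. {..Poly_Mapping.lookup m i})"
    by (auto simp: antidiag_def lookup_add)
  then have fin: "finite (?r ` antidiag m)"
    by (rule finite_subset) (auto intro: finite_PiE)
  have "inj_on ?r (antidiag m)"
  proof (rule inj_onI)
    fix p q assume p: "p \<in> antidiag m" and q: "q \<in> antidiag m" and eq: "?r p = ?r q"
    have "Poly_Mapping.lookup (fst p) i = Poly_Mapping.lookup (fst q) i" for i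
    proof (cases "i \<in> Poly_Mapping.keys m")
      case True
      then show ?thesis using fun_cong[OF eq, of i] by simp
    next
      case False
      then have "Poly_Mapping.lookup m i = 0" by (simp add: in_keys_iff)
      moreover have "m = fst p + snd p" "m = fst q + snd q"
        using p q by (auto simp: antidiag_def)
      ultimately show ?thesis
        by (metis add_is_0 lookup_add)
    qed
    then have "fst p = fst q" by (simp add: poly_mapping_eqI)
    moreover have "fst p + snd p = fst q + snd q"
      using p q by (auto simp: antidiag_def)
    ultimately show "p = q" by (simp add: prod_eq_iff)
  qed
  then show ?thesis using fin finite_imageD by blast
qed

instantiation mps :: (comm_ring_1) comm_ring_1
begin

lift_definition zero_mps :: "'a mps" is "\<lambda>_. 0" .
lift_definition one_mps :: "'a mps" is "\<lambda>m. if m = 0 then 1 else 0" .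
lift_definition plus_mps :: "'a mps \<Rightarrow> 'a mps \<Rightarrow> 'a mps" is "\<lambda>f g m. f m + g m" .
lift_definition minus_mps :: "'a mps \<Rightarrow> 'a mps \<Rightarrow> 'a mps" is "\<lambda>f g m. f m - g m" .
lift_definition uminus_mps :: "'a mps \<Rightarrow> 'a mps" is "\<lambda>f m. - f m" .
lift_definition times_mps :: "'a mps \<Rightarrow> 'a mps \<Rightarrow> 'a mps"
  is "\<lambda>f g m. \<Sum>(a, b)\<in>antidiag m. f a * g b" .

instance
proof
  fix f g h :: "'a mps"
  show "f * g * h = f * (g * h)"
  proof (rule mps_eqI)
    fix m
    have "mps_nth (f * g * h) m =
        (\<Sum>(p, q)\<in>(SIGMA p:antidiag m. antidiag (fst p)).
           mps_nth f (fst q) * mps_nth g (snd q) * mps_nth h (snd p))"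
      by (subst sum.Sigma[symmetric])
         (simp_all add: times_mps.rep_eq sum_distrib_right case_prod_unfold)
    also have "\<dots> = (\<Sum>(p, q)\<in>(SIGMA p:antidiag m. antidiag (snd p)).
           mps_nth f (fst p) * (mps_nth g (fst q) * mps_nth h (snd q)))"
      by (rule sum.reindex_bij_witness[where
            i = "\<lambda>((a, _), (b, c)). ((a + b, c), (a, b))" and
            j = "\<lambda>((_, c), (a, b)). ((a, b + c), (b, c))"])
         (auto simp: antidiag_def add.assoc mult.assoc)
    also have "\<dots> = mps_nth (f * (g * h)) m"
      by (subst sum.Sigma[symmetric])
         (simp_all add: times_mps.rep_eq sum_distrib_left case_prod_unfold)
    finally show "mps_nth (f * g * h) m = mps_nth (f * (g * h)) m" .
  qed
  show "f * g = g * f"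
  proof (rule mps_eqI)
    fix m
    show "mps_nth (f * g) m = mps_nth (g * f) m"
      unfolding times_mps.rep_eq
      by (rule sum.reindex_bij_witness[where i = prod.swap and j = prod.swap])
         (auto simp: antidiag_def add.commute mult.commute)
  qed
  show "1 * f = f"
  proof (rule mps_eqI)
    fix m
    have "mps_nth (1 * f) m = (\<Sum>p\<in>antidiag m. if p = (0, m) then mps_nth f m else 0)"
      unfolding times_mps.rep_eq
      by (rule sum.cong) (auto simp: one_mps.rep_eq split: if_splits)
    then show "mps_nth (1 * f) m = mps_nth f m" by simp
  qed
  show "(f + g) * h = f * h + g * h"
    by (rule mps_eqI)
       (simp add: times_mps.rep_eq plus_mps.rep_eq case_prod_unfold algebra_simps sum.distrib)
  show "(0 :: 'a mps) \<noteq> 1"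
  proof
    assume "(0 :: 'a mps) = 1"
    then have "mps_nth (0 :: 'a mps) 0 = mps_nth 1 0" by simp
    then show False by (simp add: zero_mps.rep_eq one_mps.rep_eq)
  qed
qed (rule mps_eqI; simp add: zero_mps.rep_eq plus_mps.rep_eq minus_mps.rep_eq
       uminus_mps.rep_eq algebra_simps)+

end

lift_definition mps_X :: "nat \<Rightarrow> 'a::comm_ring_1 mps"
  is "\<lambda>i m. if m = Poly_Mapping.single i 1 then 1 else 0" .

text \<open>The one-variable series \<open>F\<close> regarded as the series \<open>F(x\<^sub>0)\<close>.\<close>

definition mps_of_fps :: "'a::comm_ring_1 fps \<Rightarrow> 'a mps" where
  "mps_of_fps F = Abs_mps (\<lambda>m.
     if Poly_Mapping.keys m \<subseteq> {0} then fps_nth F (Poly_Mapping.lookup m 0) else 0)"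

lemma mps_nth_mps_of_fps:
  "mps_nth (mps_of_fps F) m =
     (if Poly_Mapping.keys m \<subseteq> {0} then fps_nth F (Poly_Mapping.lookup m 0) else 0)"
  by (simp add: mps_of_fps_def Abs_mps_inverse)

text \<open>The formal partial derivative \<open>\<partial>/\<partial>x\<^sub>i\<close>.\<close>

lift_definition mps_deriv :: "nat \<Rightarrow> 'a::comm_ring_1 mps \<Rightarrow> 'a mps"
  is "\<lambda>i f m. of_nat (Poly_Mapping.lookup m i + 1) * f (m + Poly_Mapping.single i 1)" .

definition op_D :: "nat \<Rightarrow> 'a::comm_ring_1 mps \<Rightarrow> 'a mps" where
  "op_D m f = (\<Sum>i<m. mps_X (i + 1) * mps_deriv i f)"

definition op_Dstar :: "nat \<Rightarrow> 'a::comm_ring_1 mps \<Rightarrow> 'a mps" where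
  "op_Dstar m f = (\<Sum>i<m. mps_X i * mps_deriv (i + 1) f)"

definition op_B :: "nat \<Rightarrow> 'a::comm_ring_1 mps \<Rightarrow> 'a mps" where
  "op_B m f = op_D m f + op_Dstar m f"

fun op_P :: "nat \<Rightarrow> 'a::comm_ring_1 mps \<Rightarrow> 'a mps" where
  "op_P 0 f = f"
| "op_P (Suc n) f = op_B (Suc n) (op_P n f)"

text \<open>
  The increasing enumeration \<open>v\<^sub>1 < \<dots> < v\<^sub>m\<close> of \<open>V\<close> is \<^term>\<open>sorted_list_of_set V\<close>, with indices
  shifted down by one. Countings are extensional functions, so each function on \<open>V\<close> is represented
  exactly once.
\<close>

definition good_ballot_countings :: "'v::linorder set \<Rightarrow> ('v \<Rightarrow> int) set" where
  "good_ballot_countings V =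
     {g \<in> V \<rightarrow>\<^sub>E {-1, 1}. \<forall>l\<in>{1..card V}. (\<Sum>j<l. g (sorted_list_of_set V ! j)) \<ge> 0}"

definition ballot_cardinal :: "'v set \<Rightarrow> ('v \<Rightarrow> int) \<Rightarrow> int" where
  "ballot_cardinal V g = (\<Sum>v\<in>V. g v)"

text \<open>
  A ballot partition is a pair \<open>(\<pi>, G)\<close> where \<open>G B\<close> is the counting attached to the block \<open>B\<close>.
\<close>

definition ballot_partitions :: "nat \<Rightarrow> (nat set set \<times> (nat set \<Rightarrow> nat \<Rightarrow> int)) set" where
  "ballot_partitions n =
     (SIGMA \<pi>:{\<pi>. partition_on {1..n} \<pi>}. \<Pi>\<^sub>E B\<in>\<pi>. good_ballot_countings B)"

lemma finite_good_ballot_countings: "finite V \<Longrightarrow> finite (good_ballot_countings V)"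
  unfolding good_ballot_countings_def by (rule finite_Collect_conjI) (simp add: finite_PiE)

lemma finite_ballot_partitions: "finite (ballot_partitions n)"
  unfolding ballot_partitions_def
proof (rule finite_SigmaI)
  show "finite {\<pi>. partition_on {1..n} \<pi>}"
    by (rule finitely_many_partition_on) simp
next
  fix \<pi> assume "\<pi> \<in> {\<pi>. partition_on {1..n} \<pi>}"
  then have part: "partition_on {1..n} \<pi>" by simp
  have "finite B" if "B \<in> \<pi>" for B
    using part that by (metis Sup_upper finite_atLeastAtMost finite_subset partition_onD1)
  moreover have "finite \<pi>"
    using part by (rule finite_elements[rotated]) simp
  ultimately show "finite (\<Pi>\<^sub>E B\<in>\<pi>. good_ballot_countings B)"
    by (intro finite_PiE finite_good_ballot_countings)
qed

lemma ballot_cardinal_nonneg: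
  assumes "finite V" "g \<in> good_ballot_countings V"
  shows "ballot_cardinal V g \<ge> 0"
proof (cases "V = {}")
  case False
  with assms(1) have "card V \<in> {1..card V}" by (simp add: Suc_le_eq card_gt_0_iff)
  with assms(2) have "(\<Sum>j<card V. g (sorted_list_of_set V ! j)) \<ge> 0"
    unfolding good_ballot_countings_def by blast
  also have "(\<Sum>j<card V. g (sorted_list_of_set V ! j)) = (\<Sum>v\<in>V. g v)"
    using assms(1)
    by (intro sum.reindex_bij_betw)
       (auto intro: bij_betw_nth)
  finally show ?thesis by (simp add: ballot_cardinal_def)
qed (simp add: ballot_cardinal_def)

text \<open>
  By the preceding lemma, ballot cardinals of good ballot countings are nonnegative, so \<^const>\<open>nat\<close>
  does not truncate here.
\<close>

definition ballot_bell :: "nat \<Rightarrow> nat \<Rightarrow> 'a::comm_ring_1 mps" where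
  "ballot_bell n k =
     (\<Sum>(\<pi>, G)\<in>{(\<pi>, G) \<in> ballot_partitions n. card \<pi> = k}.
        \<Prod>B\<in>\<pi>. mps_X (nat (ballot_cardinal B (G B))))"

end

theory Submission
  imports Defs
begin

text \<open>
  The operators \<open>\<B>\<^sub>m\<close> are derivations. Applied to \<open>F\<^sup>(\<^sup>k\<^sup>)\<close> times a product of variables, one for each
  block, \<open>\<B>\<^sub>n\<^sub>+\<^sub>1\<close> either hits \<open>F\<^sup>(\<^sup>k\<^sup>)\<close>, which opens the new block \<open>{n + 1}\<close> with ballot cardinal 1, or
  replaces one \<open>x\<^sub>i\<close> by \<open>x\<^sub>i\<^sub>+\<^sub>1 + x\<^sub>i\<^sub>-\<^sub>1\<close> (without the second term if \<open>i = 0\<close>), which appends \<open>n + 1\<close> to the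
  corresponding block with value \<open>1\<close> or \<open>-1\<close>.
\<close>

section \<open>Formal partial derivatives: Leibniz rule and values on generators\<close>

lemma mps_deriv_add: "mps_deriv i (f + g) = mps_deriv i f + mps_deriv i g"
  by (rule mps_eqI) (simp add: mps_deriv.rep_eq plus_mps.rep_eq algebra_simps)

text \<open>Terms in which \<open>a\<close> has exponent 0 at \<open>i\<close> vanish; lowering that
  exponent by one reindexes the others. Since \<open>h\<close> is arbitrary, the lemma serves both
  halves of the Leibniz rule.\<close>

lemma sum_antidiag_add_single:
  "(\<Sum>(a, b)\<in>antidiag (m + Poly_Mapping.single i 1).
      of_nat (Poly_Mapping.lookup a i) * h a b) =
   (\<Sum>(a, b)\<in>antidiag m.
      of_nat (Poly_Mapping.lookup a i + 1) * (h (a + Poly_Mapping.single i 1) b :: 'a::comm_ring_1))"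
    (is "?lhs = ?rhs")
proof -
  let ?e = "Poly_Mapping.single i (1::nat)"
  let ?S = "{p \<in> antidiag (m + ?e). Poly_Mapping.lookup (fst p) i \<noteq> 0}"
  \<comment> \<open>Subtraction of exponents truncates at 0, so it can be undone only where the
    exponent at \<open>i\<close> is nonzero.\<close>
  have split: "a - ?e + ?e = a" if "Poly_Mapping.lookup a i \<noteq> 0" for a :: "nat \<Rightarrow>\<^sub>0 nat"
    using that by (intro poly_mapping_eqI) (auto simp: lookup_add lookup_minus lookup_single when_def)
  have "?lhs = (\<Sum>(a, b)\<in>?S. of_nat (Poly_Mapping.lookup a i) * h a b)"
    by (rule sum.mono_neutral_right) (auto intro!: gr0I)
  also have "\<dots> = ?rhs"
  proof (rule sum.reindex_bij_witness[where
        i = "\<lambda>(a, b). (a + ?e, b)" and j = "\<lambda>(a, b). (a - ?e, b)"])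
    fix p assume p: "p \<in> ?S"
    obtain a b where ab: "p = (a, b)" by force
    with p have a: "Poly_Mapping.lookup a i \<noteq> 0" and sum: "a + b = m + ?e" by auto
    have eq: "a - ?e + ?e = a" using a by (rule split)
    then show "(case case p of (a, b) \<Rightarrow> (a - ?e, b) of (a, b) \<Rightarrow> (a + ?e, b)) = p"
      by (simp add: ab)
    have "a - ?e + b + ?e = m + ?e"
      using sum eq by (metis add.assoc add.commute)
    then show "(case p of (a, b) \<Rightarrow> (a - ?e, b)) \<in> antidiag m"
      by (simp add: ab)
    have "Poly_Mapping.lookup (a - ?e) i + 1 = Poly_Mapping.lookup a i"
      using a by (simp add: lookup_minus)
    then show "(case case p of (a, b) \<Rightarrow> (a - ?e, b) of (a, b) \<Rightarrow>
        of_nat (Poly_Mapping.lookup a i + 1) * h (a + ?e) b) =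
        (case p of (a, b) \<Rightarrow> of_nat (Poly_Mapping.lookup a i) * h a b)"
      by (simp only: ab prod.case eq)
  qed (auto simp: lookup_add ac_simps)
  finally show ?thesis .
qed

text \<open>If \<open>a + b = m + ?e\<close>, the derivative's factor \<open>?l m + 1\<close> equals
  \<open>?l a + ?l b\<close>. The coefficient sum splits accordingly, and the shift lemma turns each
  half into one Leibniz term, the second half after exchanging \<open>a\<close> and
  \<open>b\<close>.\<close>

lemma mps_deriv_mult:
  "mps_deriv i (f * g) = mps_deriv i f * g + f * mps_deriv i (g :: 'a::comm_ring_1 mps)"
proof (rule mps_eqI)
  fix m
  let ?e = "Poly_Mapping.single i (1::nat)"
  let ?l = "\<lambda>a. Poly_Mapping.lookup a i"
  have swap: "(\<Sum>(a, b)\<in>antidiag k. h a b) = (\<Sum>(a, b)\<in>antidiag k. h b a)"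
    for k and h :: "_ \<Rightarrow> _ \<Rightarrow> 'a"
    by (rule sum.reindex_bij_witness[where i = prod.swap and j = prod.swap])
       (auto simp: antidiag_def add.commute)
  have "mps_nth (mps_deriv i (f * g)) m =
      (\<Sum>(a, b)\<in>antidiag (m + ?e). of_nat (?l m + 1) * (mps_nth f a * mps_nth g b))"
    by (simp only: mps_deriv.rep_eq times_mps.rep_eq sum_distrib_left case_prod_unfold)
  also have "\<dots> = (\<Sum>(a, b)\<in>antidiag (m + ?e). of_nat (?l a) * (mps_nth f a * mps_nth g b)
      + of_nat (?l b) * (mps_nth f a * mps_nth g b))"
  proof (rule sum.cong, simp, clarify)
    fix a b assume "(a, b) \<in> antidiag (m + ?e)"
    then have "?l (a + b) = ?l (m + ?e)" by simp
    then have "?l m + 1 = ?l a + ?l b" by (simp add: lookup_add)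
    then have "of_nat (?l m + 1) = (of_nat (?l a) + of_nat (?l b) :: 'a)"
      by (metis of_nat_add)
    then show "of_nat (?l m + 1) * (mps_nth f a * mps_nth g b) =
        of_nat (?l a) * (mps_nth f a * mps_nth g b) + of_nat (?l b) * (mps_nth f a * mps_nth g b)"
      by (simp only: distrib_right)
  qed
  also have "\<dots> = (\<Sum>(a, b)\<in>antidiag (m + ?e). of_nat (?l a) * (mps_nth f a * mps_nth g b)) +
      (\<Sum>(a, b)\<in>antidiag (m + ?e). of_nat (?l b) * (mps_nth f a * mps_nth g b))"
    by (simp only: case_prod_unfold sum.distrib)
  also have "(\<Sum>(a, b)\<in>antidiag (m + ?e). of_nat (?l b) * (mps_nth f a * mps_nth g b)) =
      (\<Sum>(a, b)\<in>antidiag (m + ?e). of_nat (?l a) * (mps_nth f b * mps_nth g a))"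
    by (rule swap)
  also have "\<dots> = (\<Sum>(a, b)\<in>antidiag m. of_nat (?l a + 1) * (mps_nth f b * mps_nth g (a + ?e)))"
    by (rule sum_antidiag_add_single)
  also have "\<dots> = mps_nth (f * mps_deriv i g) m"
    by (subst swap) (simp add: mps_deriv.rep_eq times_mps.rep_eq mult.left_commute)
  also have "(\<Sum>(a, b)\<in>antidiag (m + ?e). of_nat (?l a) * (mps_nth f a * mps_nth g b)) =
      (\<Sum>(a, b)\<in>antidiag m. of_nat (?l a + 1) * (mps_nth f (a + ?e) * mps_nth g b))"
    by (rule sum_antidiag_add_single)
  also have "\<dots> = mps_nth (mps_deriv i f * g) m"
    by (simp add: mps_deriv.rep_eq times_mps.rep_eq mult.assoc)
  finally show "mps_nth (mps_deriv i (f * g)) m = mps_nth (mps_deriv i f * g + f * mps_deriv i g) m"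
    by (simp add: plus_mps.rep_eq)
qed

lemma mps_deriv_X: "mps_deriv i (mps_X j) = (if i = j then 1 else 0)"
proof (rule mps_eqI)
  fix m :: "nat \<Rightarrow>\<^sub>0 nat"
  have "m = 0 \<and> i = j" if "m + Poly_Mapping.single i 1 = Poly_Mapping.single j (1::nat)"
  proof -
    have eq: "Poly_Mapping.lookup m k + (if i = k then 1 else 0) = (if j = k then 1 else 0)" for k
      using arg_cong[OF that, of "\<lambda>p. Poly_Mapping.lookup p k"]
      by (cases "i = k"; cases "j = k") (simp_all add: lookup_add lookup_single)
    have "i = j" using eq[of i] by (auto split: if_splits)
    moreover have "m = 0" using eq \<open>i = j\<close> by (intro poly_mapping_eqI) simp
    ultimately show ?thesis by simp
  qed
  then show "mps_nth (mps_deriv i (mps_X j)) m = mps_nth (if i = j then 1 else 0 :: 'a mps) m"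
    by (auto simp: mps_deriv.rep_eq mps_X.rep_eq one_mps.rep_eq zero_mps.rep_eq)
qed

lemma mps_deriv_mps_of_fps:
  "mps_deriv i (mps_of_fps F) = (if i = 0 then mps_of_fps (fps_deriv F) else 0)"
proof (rule mps_eqI)
  fix m :: "nat \<Rightarrow>\<^sub>0 nat"
  \<comment> \<open>Raising the exponent at \<open>i\<close> puts \<open>i\<close> into the support.
    For nonzero \<open>i\<close> the shifted monomial thus has coefficient 0 in
    \<open>mps_of_fps F\<close>; for \<open>i = 0\<close> it gives the coefficient of
    \<open>fps_deriv F\<close>.\<close>
  have "Poly_Mapping.keys (m + Poly_Mapping.single i 1) = insert i (Poly_Mapping.keys m)"
    by (auto simp: in_keys_iff lookup_add lookup_single when_def split: if_splits)
  then show "mps_nth (mps_deriv i (mps_of_fps F)) m =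
      mps_nth (if i = 0 then mps_of_fps (fps_deriv F) else 0) m"
    by (auto simp: mps_deriv.rep_eq mps_nth_mps_of_fps zero_mps.rep_eq lookup_add)
qed

section \<open>The operators \<open>op_B\<close> as derivations\<close>

lemma op_B_add: "op_B m (f + g) = op_B m f + op_B m g"
  by (simp add: op_B_def op_D_def op_Dstar_def mps_deriv_add algebra_simps sum.distrib)

lemma op_B_mult: "op_B m (f * g) = op_B m f * g + f * op_B m g"
  by (simp add: op_B_def op_D_def op_Dstar_def mps_deriv_mult algebra_simps sum.distrib
      sum_distrib_left)

lemma op_B_zero: "op_B m 0 = 0"
  using op_B_add[of m 0 0] by simp

lemma op_B_one: "op_B m 1 = 0"
  using op_B_mult[of m 1 1] by simp

lemma op_B_sum: "op_B m (sum f A) = (\<Sum>x\<in>A. op_B m (f x))"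
  by (induction A rule: infinite_finite_induct) (simp_all add: op_B_zero op_B_add)

lemma op_B_prod:
  assumes "finite A"
  shows "op_B m (prod f A) = (\<Sum>x\<in>A. op_B m (f x) * prod f (A - {x}))"
  using assms
proof (induction A)
  case empty
  then show ?case by (simp add: op_B_one)
next
  case (insert y A)
  have "prod f (insert y A - {x}) = f y * prod f (A - {x})" if "x \<in> A" for x
  proof -
    have "insert y A - {x} = insert y (A - {x})" using that insert.hyps by auto
    then show ?thesis using insert.hyps by simp
  qed
  then show ?case
    using insert by (simp add: op_B_mult sum_distrib_left ac_simps)
qed

text \<open>Only the derivative in x_0 survives. It occurs in \<open>op_D m\<close> because
  \<open>m\<close> is at least 1, while \<open>op_Dstar\<close> differentiates only in variables of
  positive index.\<close>

lemma op_B_mps_of_fps: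
  assumes "m \<ge> 1"
  shows "op_B m (mps_of_fps F) = mps_of_fps (fps_deriv F) * mps_X 1"
proof -
  have "op_D m (mps_of_fps F) = (\<Sum>i<m. if i = 0 then mps_X 1 * mps_of_fps (fps_deriv F) else 0)"
    unfolding op_D_def by (rule sum.cong) (auto simp: mps_deriv_mps_of_fps)
  also have "\<dots> = mps_X 1 * mps_of_fps (fps_deriv F)"
    using assms by simp
  finally show ?thesis
    by (simp add: op_B_def op_Dstar_def mps_deriv_mps_of_fps mult.commute)
qed

text \<open>The bound \<open>j < m\<close> makes the ranges of both sums long enough to contain the
  term that raises the index \<open>j\<close> and, for positive \<open>j\<close>, the one that
  lowers it.\<close>

lemma op_B_X:
  assumes "j < m"
  shows "op_B m (mps_X j) = mps_X (j + 1) + (if j = 0 then 0 else mps_X (j - 1))"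
proof -
  have "op_D m (mps_X j :: 'a mps) = (\<Sum>i<m. if i = j then mps_X (i + 1) else 0)"
    unfolding op_D_def by (rule sum.cong) (auto simp: mps_deriv_X)
  \<comment> \<open>For \<open>j = 0\<close> truncated subtraction makes \<open>j - 1\<close> equal
    to 0, and the inner conditional removes the spurious term at \<open>i = 0\<close>.\<close>
  moreover have "op_Dstar m (mps_X j :: 'a mps) =
      (\<Sum>i<m. if i = j - 1 then (if j = 0 then 0 else mps_X i) else 0)"
    unfolding op_Dstar_def by (rule sum.cong) (auto simp: mps_deriv_X)
  ultimately show ?thesis
    using assms by (auto simp: op_B_def)
qed

section \<open>The weight of a single block and its growth by a new maximum\<close>

text \<open>The total contribution of one block. Countings on different blocks are chosen
  independently, so for a fixed set partition the sum over all of them is a product of these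
  weights.\<close>

definition ballot_weight :: "'v::linorder set \<Rightarrow> 'a::comm_ring_1 mps" where
  "ballot_weight V = (\<Sum>g\<in>good_ballot_countings V. mps_X (nat (ballot_cardinal V g)))"

lemma sum_sorted_list_of_set:
  fixes h :: "'v::linorder \<Rightarrow> int"
  assumes "finite V"
  shows "(\<Sum>j<card V. h (sorted_list_of_set V ! j)) = sum h V"
  using assms by (intro sum.reindex_bij_betw) (auto intro: bij_betw_nth)

text \<open>The new maximum \<open>v\<close> comes last in the enumeration, so the earlier partial
  sums are those of the restriction and only the total sum gives a new condition.\<close>

lemma good_ballot_countings_insert_iff:
  fixes v :: "'v::linorder"
  assumes "finite V" and v: "\<And>u. u \<in> V \<Longrightarrow> u < v"
  shows "h \<in> good_ballot_countings (insert v V) \<longleftrightarrow>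
    h \<in> insert v V \<rightarrow>\<^sub>E {-1, 1} \<and> restrict h V \<in> good_ballot_countings V \<and> 0 \<le> sum h V + h v"
proof -
  have "v \<notin> V" using v by blast
  \<comment> \<open>The appended list is sorted and distinct, hence it is the sorted list of its own
    set of elements.\<close>
  have list: "sorted_list_of_set (insert v V) = sorted_list_of_set V @ [v]"
    using assms \<open>v \<notin> V\<close>
      sorted_list_of_set.idem_if_sorted_distinct[of "sorted_list_of_set V @ [v]"]
    by (simp add: sorted_append less_imp_le)
  have len: "length (sorted_list_of_set V) = card V" by simp
  have pre: "(\<Sum>j<l. h (sorted_list_of_set (insert v V) ! j)) =
      (\<Sum>j<l. restrict h V (sorted_list_of_set V ! j))" if "l \<le> card V" for l
  proof (rule sum.cong, simp)
    fix j assume "j \<in> {..<l}"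
    then have j: "j < length (sorted_list_of_set V)" using that by simp
    then have "sorted_list_of_set V ! j \<in> V"
      using nth_mem[OF j] assms(1) by simp
    then show "h (sorted_list_of_set (insert v V) ! j) = restrict h V (sorted_list_of_set V ! j)"
      using j by (simp add: list nth_append)
  qed
  have "(\<Sum>j<Suc (card V). h (sorted_list_of_set (insert v V) ! j)) =
      (\<Sum>j<card V. restrict h V (sorted_list_of_set V ! j)) + h v"
    using pre[of "card V"] len by (simp add: list nth_append)
  also have "(\<Sum>j<card V. restrict h V (sorted_list_of_set V ! j)) = sum h V"
    using sum_sorted_list_of_set[OF assms(1), of "restrict h V"] by simp
  finally have last: "(\<Sum>j<Suc (card V). h (sorted_list_of_set (insert v V) ! j)) = sum h V + h v" .
  have "{1..card (insert v V)} = insert (Suc (card V)) {1..card V}"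
    using assms(1) \<open>v \<notin> V\<close> by auto
  then show ?thesis
    unfolding good_ballot_countings_def using last pre by auto
qed

text \<open>A good counting with cardinal c extends to \<open>v\<close> by any value e with c + e
  nonnegative, and these c + e are exactly the indices into which the operator turns x_c. As c is at
  most \<open>card V\<close>, the bound on \<open>m\<close> allows \<open>op_B_X\<close> to be
  applied.\<close>

lemma op_B_ballot_weight:
  fixes v :: "'v::linorder"
  assumes "finite V" and v: "\<And>u. u \<in> V \<Longrightarrow> u < v" and m: "card V < m"
  shows "op_B m (ballot_weight V) = (ballot_weight (insert v V) :: 'a::comm_ring_1 mps)"
proof -
  have "v \<notin> V" using v by blast
  have insert_iff: "h \<in> good_ballot_countings (insert v V) \<longleftrightarrow>
      h \<in> insert v V \<rightarrow>\<^sub>E {-1, 1} \<and> restrict h V \<in> good_ballot_countings V \<and> 0 \<le> sum h V + h v" for h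
    using assms(1) v by (rule good_ballot_countings_insert_iff)
  \<comment> \<open>The admissible values at \<open>v\<close>: only 1 if the cardinal is 0,
    otherwise both signs.\<close>
  let ?E = "\<lambda>g. {e \<in> {-1, 1}. 0 \<le> ballot_cardinal V g + e}"
  have step: "op_B m (mps_X (nat (ballot_cardinal V g)) :: 'a mps) =
      (\<Sum>e\<in>?E g. mps_X (nat (ballot_cardinal V g + e)))"
    if g: "g \<in> good_ballot_countings V" for g
  proof -
    have ge: "0 \<le> ballot_cardinal V g"
      using assms(1) g by (rule ballot_cardinal_nonneg)
    have "ballot_cardinal V g \<le> (\<Sum>u\<in>V. 1)"
      unfolding ballot_cardinal_def
      using g by (intro sum_mono) (auto simp: good_ballot_countings_def PiE_iff)
    with m ge have lt: "nat (ballot_cardinal V g) < m" by simp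
    show ?thesis
    proof (cases "ballot_cardinal V g = 0")
      case True
      then have "?E g = {1}" by auto
      then show ?thesis using True lt by (simp add: op_B_X)
    next
      case False
      with ge have "?E g = {-1, 1}" by auto
      moreover have "nat (ballot_cardinal V g) \<noteq> 0"
        "nat (ballot_cardinal V g + 1) = nat (ballot_cardinal V g) + 1"
        "nat (ballot_cardinal V g + -1) = nat (ballot_cardinal V g) - 1"
        using False ge by auto
      ultimately show ?thesis
        by (simp only: op_B_X[OF lt]) simp
    qed
  qed
  have "op_B m (ballot_weight V :: 'a mps) =
      (\<Sum>g\<in>good_ballot_countings V. \<Sum>e\<in>?E g. mps_X (nat (ballot_cardinal V g + e)))"
    unfolding ballot_weight_def op_B_sum by (rule sum.cong) (auto simp: step)
  also have "\<dots> = (\<Sum>(g, e)\<in>Sigma (good_ballot_countings V) ?E. mps_X (nat (ballot_cardinal V g + e)))"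
    using assms(1) by (intro sum.Sigma) (auto intro: finite_good_ballot_countings)
  also have "\<dots> = ballot_weight (insert v V)"
    unfolding ballot_weight_def
  proof (rule sum.reindex_bij_witness[where
        i = "\<lambda>h. (restrict h V, h v)" and j = "\<lambda>(g, e). g(v := e)"])
    fix p assume p: "p \<in> Sigma (good_ballot_countings V) ?E"
    obtain g e where ge: "p = (g, e)" by force
    with p have g: "g \<in> good_ballot_countings V" and e: "e \<in> ?E g" by auto
    then have gE: "g \<in> V \<rightarrow>\<^sub>E {-1, 1}" by (simp add: good_ballot_countings_def)
    have restr: "restrict (g(v := e)) V = g"
      using gE \<open>v \<notin> V\<close> by (auto simp: restrict_def PiE_iff extensional_def)
    have sum: "sum (g(v := e)) V = ballot_cardinal V g"
      unfolding ballot_cardinal_def using \<open>v \<notin> V\<close> by (intro sum.cong) auto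
    show "(restrict (case p of (g, e) \<Rightarrow> g(v := e)) V, (case p of (g, e) \<Rightarrow> g(v := e)) v) = p"
      using restr by (simp add: ge)
    show "(case p of (g, e) \<Rightarrow> g(v := e)) \<in> good_ballot_countings (insert v V)"
      using g e gE restr sum
      unfolding ge prod.case insert_iff
      by (auto simp: PiE_iff extensional_def)
    show "mps_X (nat (ballot_cardinal (insert v V) (case p of (g, e) \<Rightarrow> g(v := e)))) =
        (case p of (g, e) \<Rightarrow> (mps_X (nat (ballot_cardinal V g + e)) :: 'a mps))"
      using sum \<open>v \<notin> V\<close> assms(1)
      by (simp add: ge ballot_cardinal_def add.commute)
  next
    fix h assume "h \<in> good_ballot_countings (insert v V)"
    then have h: "h \<in> insert v V \<rightarrow>\<^sub>E {-1, 1}" "restrict h V \<in> good_ballot_countings V"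
      "0 \<le> sum h V + h v"
      unfolding insert_iff by auto
    show "(case (restrict h V, h v) of (g, e) \<Rightarrow> g(v := e)) = h"
      using h(1) by (auto simp: restrict_def PiE_iff extensional_def)
    show "(restrict h V, h v) \<in> Sigma (good_ballot_countings V) ?E"
      using h by (auto simp: ballot_cardinal_def PiE_iff)
  qed
  finally show ?thesis .
qed

text \<open>The empty set carries exactly one counting, of cardinal 0, so its weight is x_0; growing
  it by \<open>v\<close> applies \<open>op_B 1\<close>, which sends x_0 to x_1.\<close>

lemma ballot_weight_singleton: "ballot_weight {v :: 'v::linorder} = (mps_X 1 :: 'a::comm_ring_1 mps)"
proof -
  have "good_ballot_countings {} = {(\<lambda>_. undefined) :: 'v \<Rightarrow> int}"
    by (simp add: good_ballot_countings_def)
  then have "ballot_weight ({} :: 'v set) = (mps_X 0 :: 'a mps)"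
    by (simp add: ballot_weight_def ballot_cardinal_def)
  then show ?thesis
    using op_B_ballot_weight[of "{}" v 1, where 'a = 'a] by (simp add: op_B_X)
qed

section \<open>Set partitions built by inserting one element\<close>

text \<open>Taking \<open>B = {}\<close>, which is never a block of \<open>\<pi>\<close>, accounts for the partitions with block \<open>{a}\<close>.\<close>

lemma sum_partition_on_insert:
  assumes "finite A" "a \<notin> A"
  shows "(\<Sum>\<pi> | partition_on (insert a A) \<pi>. \<phi> \<pi>) =
    (\<Sum>\<pi> | partition_on A \<pi>. \<Sum>B\<in>insert {} \<pi>. \<phi> (insert (insert a B) (\<pi> - {B})))"
proof -
  have fin: "finite {\<pi>. partition_on A \<pi>}"
    using assms(1) by (rule finitely_many_partition_on)
  have "finite \<pi>" if "partition_on A \<pi>" for \<pi>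
    using assms(1) that by (rule finite_elements)
  then have "(\<Sum>\<pi> | partition_on A \<pi>. \<Sum>B\<in>insert {} \<pi>. \<phi> (insert (insert a B) (\<pi> - {B}))) =
    (\<Sum>(\<pi>, B)\<in>(SIGMA \<pi>:{\<pi>. partition_on A \<pi>}. insert {} \<pi>). \<phi> (insert (insert a B) (\<pi> - {B})))"
    using fin by (intro sum.Sigma) auto
  also have "\<dots> = (\<Sum>\<pi> | partition_on (insert a A) \<pi>. \<phi> \<pi>)"
  \<comment> \<open>The inverse map takes the block \<open>C\<close> containing \<open>a\<close> and
    deletes \<open>a\<close> from it; removing \<open>{{}}\<close> covers the case
    \<open>C = {a}\<close>, where nothing of the block remains.\<close>
  proof (rule sum.reindex_bij_witness[where
        j = "\<lambda>(\<pi>, B). insert (insert a B) (\<pi> - {B})" and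
        i = "\<lambda>\<rho>. let C = (THE C. C \<in> \<rho> \<and> a \<in> C) in
               (insert (C - {a}) (\<rho> - {C}) - {{}}, C - {a})"])
    fix p assume p: "p \<in> (SIGMA \<pi>:{\<pi>. partition_on A \<pi>}. insert {} \<pi>)"
    obtain \<pi> B where pB: "p = (\<pi>, B)" by force
    with p have part: "partition_on A \<pi>" and B: "B = {} \<or> B \<in> \<pi>" by auto
    have nin: "a \<notin> C" if "C \<in> \<pi>" for C
      using part assms(2) that by (auto simp: partition_on_def)
    have ne: "{} \<notin> \<pi>" using part by (simp add: partition_on_def)
    let ?\<rho> = "insert (insert a B) (\<pi> - {B})"
    have C: "(THE C. C \<in> ?\<rho> \<and> a \<in> C) = insert a B"
      using nin by (intro the_equality) auto
    have aB: "insert a B - {a} = B" using nin B by auto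
    have "?\<rho> - {insert a B} = \<pi> - {B}" using nin by auto
    moreover have "insert B (\<pi> - {B}) - {{}} = \<pi>" using B ne by auto
    ultimately show "(let C = (THE C. C \<in> (case p of (\<pi>, B) \<Rightarrow> insert (insert a B) (\<pi> - {B})) \<and> a \<in> C) in
        (insert (C - {a}) ((case p of (\<pi>, B) \<Rightarrow> insert (insert a B) (\<pi> - {B})) - {C}) - {{}}, C - {a})) = p"
      unfolding pB prod.case C Let_def aB by simp
    have dis: "disjnt B (\<Union> (\<pi> - {B}))"
      using part B unfolding partition_on_def disjoint_def disjnt_def by blast
    have "B \<subseteq> A" using part B by (auto simp: partition_on_def)
    have "partition_on (A - B) (\<pi> - {B})"
    proof (cases "B \<in> \<pi>")
      case True
      then show ?thesis using partition_on_insert[OF dis, of A] part by (simp add: insert_absorb)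
    next
      case False
      then show ?thesis using part B by simp
    qed
    moreover have "insert a A - insert a B = A - B" using assms(2) by auto
    moreover have "disjnt (insert a B) (\<Union> (\<pi> - {B}))" using dis nin by (auto simp: disjnt_def)
    ultimately have "partition_on (insert a A) ?\<rho>"
      using \<open>B \<subseteq> A\<close> by (auto simp: partition_on_insert)
    then show "(case p of (\<pi>, B) \<Rightarrow> insert (insert a B) (\<pi> - {B})) \<in> {\<pi>. partition_on (insert a A) \<pi>}"
      by (simp add: pB)
  next
    fix \<rho> assume "\<rho> \<in> {\<pi>. partition_on (insert a A) \<pi>}"
    then have part: "partition_on (insert a A) \<rho>" by simp
    then obtain C where C: "C \<in> \<rho>" "a \<in> C" by (auto simp: partition_on_def)
    have uniq: "D = C" if "D \<in> \<rho>" "a \<in> D" for D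
      using part C that unfolding partition_on_def disjoint_def by blast
    have the: "(THE C. C \<in> \<rho> \<and> a \<in> C) = C"
    proof (rule the_equality)
      show "C \<in> \<rho> \<and> a \<in> C" using C by simp
      show "D = C" if "D \<in> \<rho> \<and> a \<in> D" for D using uniq[of D] that by blast
    qed
    have ne: "{} \<notin> \<rho>" using part by (simp add: partition_on_def)
    \<comment> \<open>The shrunken block must not coincide with a block already present, or removing
      it again would not give back \<open>\<rho> - {C}\<close>. Being nonempty, such a block would
      meet \<open>C\<close>.\<close>
    have Ca: "C - {a} \<notin> \<rho>"
    proof
      assume mem: "C - {a} \<in> \<rho>"
      then have "C - {a} \<noteq> {}" using ne by metis
      moreover have "C - {a} \<noteq> C" using C by auto
      then have "(C - {a}) \<inter> C = {}"
        using part C mem by (auto simp: partition_on_def disjoint_def)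
      ultimately show False by auto
    qed
    let ?\<pi> = "insert (C - {a}) (\<rho> - {C}) - {{}}"
    have ins: "insert a (C - {a}) = C" using C by auto
    have "?\<pi> - {C - {a}} = \<rho> - {C}" using Ca ne by auto
    then show "(case let C = (THE C. C \<in> \<rho> \<and> a \<in> C) in
        (insert (C - {a}) (\<rho> - {C}) - {{}}, C - {a}) of (\<pi>, B) \<Rightarrow> insert (insert a B) (\<pi> - {B})) = \<rho>"
      unfolding the Let_def prod.case ins using C by auto
    have dis: "disjnt C (\<Union> (\<rho> - {C}))"
      using part C unfolding partition_on_def disjoint_def disjnt_def by blast
    have "partition_on (insert a A - C) (\<rho> - {C})" and sub: "C \<subseteq> insert a A"
      using partition_on_insert[OF dis, of "insert a A"] part C by (simp_all add: insert_absorb)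
    moreover have "insert a A - C = A - (C - {a})" using C assms(2) by auto
    ultimately have rest: "partition_on (A - (C - {a})) (\<rho> - {C})" by simp
    have "partition_on A ?\<pi>"
    proof (cases "C - {a} = {}")
      case True
      then have "?\<pi> = \<rho> - {C}" using ne by auto
      then show ?thesis using rest True by simp
    next
      case False
      then have "?\<pi> = insert (C - {a}) (\<rho> - {C})" using ne by auto
      moreover have "disjnt (C - {a}) (\<Union> (\<rho> - {C}))" using dis by (auto simp: disjnt_def)
      ultimately show ?thesis using rest sub False by (auto simp: partition_on_insert)
    qed
    then show "(let C = (THE C. C \<in> \<rho> \<and> a \<in> C) in (insert (C - {a}) (\<rho> - {C}) - {{}}, C - {a}))
        \<in> (SIGMA \<pi>:{\<pi>. partition_on A \<pi>}. insert {} \<pi>)"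
      unfolding the Let_def by auto
  qed auto
  finally show ?thesis by simp
qed

section \<open>Bell polynomials, the induction on \<open>n\<close>, and grouping by number of
  blocks\<close>

text \<open>Summing over the countings first, \<open>prod_sum_PiE\<close> exchanges the sum over
  families \<open>G\<close> with the product over blocks.\<close>

lemma ballot_bell_eq:
  "ballot_bell n k = (\<Sum>\<pi> | partition_on {1..n} \<pi> \<and> card \<pi> = k. \<Prod>B\<in>\<pi>. ballot_weight B)"
proof -
  let ?P = "{\<pi>. partition_on {1..n} \<pi> \<and> card \<pi> = k}"
  have finP: "finite ?P"
    by (rule finite_subset[OF _ finitely_many_partition_on[of "{1..n}"]]) auto
  have fin: "finite \<pi>" "B \<in> \<pi> \<Longrightarrow> finite B" if "\<pi> \<in> ?P" for \<pi> B
  proof -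
    have part: "partition_on {1..n} \<pi>" using that by simp
    show "finite \<pi>" using part by (rule finite_elements[rotated]) simp
    show "finite B" if "B \<in> \<pi>"
      using part that by (metis Sup_upper finite_atLeastAtMost finite_subset partition_onD1)
  qed
  have "{(\<pi>, G) \<in> ballot_partitions n. card \<pi> = k} =
      (SIGMA \<pi>:?P. \<Pi>\<^sub>E B\<in>\<pi>. good_ballot_countings B)"
    by (auto simp: ballot_partitions_def)
  then have "ballot_bell n k = (\<Sum>\<pi>\<in>?P. \<Sum>G\<in>(\<Pi>\<^sub>E B\<in>\<pi>. good_ballot_countings B).
      \<Prod>B\<in>\<pi>. mps_X (nat (ballot_cardinal B (G B))) :: 'a mps)"
    unfolding ballot_bell_def using finP fin
    by (simp only:) (intro sum.Sigma[symmetric] ballI finite_PiE finite_good_ballot_countings; blast)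
  also have "\<dots> = (\<Sum>\<pi>\<in>?P. \<Prod>B\<in>\<pi>. ballot_weight B)"
    unfolding ballot_weight_def using fin
    by (intro sum.cong refl prod_sum_PiE[symmetric]) (auto intro: finite_good_ballot_countings)
  finally show ?thesis .
qed

text \<open>Summing over all set partitions at once, with \<open>card \<pi>\<close> as the order of
  the derivative, lets the induction run without a recurrence in k. The Leibniz terms for one
  \<open>\<pi>\<close> match the summands of \<open>sum_partition_on_insert\<close>.\<close>

lemma op_P_mps_of_fps:
  "op_P n (mps_of_fps F) =
    (\<Sum>\<pi> | partition_on {1..n} \<pi>. mps_of_fps ((fps_deriv ^^ card \<pi>) F) * (\<Prod>B\<in>\<pi>. ballot_weight B))"
proof (induction n)
  case 0
  show ?case by (simp add: partition_on_empty)
next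
  case (Suc n)
  let ?\<phi> = "\<lambda>\<pi>. mps_of_fps ((fps_deriv ^^ card \<pi>) F) * (\<Prod>B\<in>\<pi>. ballot_weight B)"
  have step: "op_B (Suc n) (?\<phi> \<pi>) =
      (\<Sum>B\<in>insert {} \<pi>. ?\<phi> (insert (insert (Suc n) B) (\<pi> - {B})))"
    if part: "partition_on {1..n} \<pi>" for \<pi>
  proof -
    have fin: "finite \<pi>" using part by (rule finite_elements[rotated]) simp
    have sub: "B \<subseteq> {1..n}" if "B \<in> \<pi>" for B
      using part that by (auto simp: partition_on_def)
    have ne: "{} \<notin> \<pi>" using part by (simp add: partition_on_def)
    \<comment> \<open>Every inserted block is genuinely new, so cardinalities and products split off
      its contribution.\<close>
    have new: "insert (Suc n) B \<notin> \<pi>" for B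
      using sub by fastforce
    \<comment> \<open>The summand \<open>B = {}\<close>: the number of blocks, and with it the order
      of the derivative, goes up by one.\<close>
    have "?\<phi> (insert {Suc n} \<pi>) =
        mps_of_fps ((fps_deriv ^^ Suc (card \<pi>)) F) * (mps_X 1 * (\<Prod>B\<in>\<pi>. ballot_weight B))"
      using fin new[of "{}"] by (simp add: ballot_weight_singleton)
    also have "\<dots> = op_B (Suc n) (mps_of_fps ((fps_deriv ^^ card \<pi>) F)) * (\<Prod>B\<in>\<pi>. ballot_weight B)"
      by (simp add: op_B_mps_of_fps mult.assoc)
    finally have empty: "?\<phi> (insert {Suc n} \<pi>) = \<dots>" .
    have block: "?\<phi> (insert (insert (Suc n) B) (\<pi> - {B})) =
        mps_of_fps ((fps_deriv ^^ card \<pi>) F) *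
          (op_B (Suc n) (ballot_weight B) * (\<Prod>B\<in>\<pi> - {B}. ballot_weight B))"
      if B: "B \<in> \<pi>" for B
    proof -
      \<comment> \<open>A block has at most \<open>n\<close> elements, so the index
        \<open>Suc n\<close> satisfies the bound in \<open>op_B_ballot_weight\<close>.\<close>
      have "card B \<le> card {1..n}" using sub[OF B] by (intro card_mono) auto
      then have "op_B (Suc n) (ballot_weight B) = (ballot_weight (insert (Suc n) B) :: 'a mps)"
        using sub[OF B] by (intro op_B_ballot_weight) (auto intro: finite_subset)
      moreover have "card (insert (insert (Suc n) B) (\<pi> - {B})) = card \<pi>"
        using fin new B card_Suc_Diff1[OF fin B] by simp
      ultimately show ?thesis using fin new by simp
    qed
    show ?thesis
      using fin ne empty block
      by (simp add: op_B_mult op_B_prod sum_distrib_left)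
  qed
  have "op_P (Suc n) (mps_of_fps F) = (\<Sum>\<pi> | partition_on {1..n} \<pi>. op_B (Suc n) (?\<phi> \<pi>))"
    by (simp add: Suc.IH op_B_sum)
  also have "\<dots> = (\<Sum>\<pi> | partition_on {1..n} \<pi>.
      \<Sum>B\<in>insert {} \<pi>. ?\<phi> (insert (insert (Suc n) B) (\<pi> - {B})))"
    by (rule sum.cong) (simp_all only: mem_Collect_eq step)
  also have "\<dots> = (\<Sum>\<pi> | partition_on (insert (Suc n) {1..n}) \<pi>. ?\<phi> \<pi>)"
    by (rule sum_partition_on_insert[symmetric]) auto
  also have "insert (Suc n) {1..n} = {1..Suc n}" by auto
  finally show ?case .
qed

theorem theorem3:
  fixes \<iota> :: "rat \<Rightarrow> 'a::comm_ring_1" and F :: "'a fps" and n :: nat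
  assumes "inj \<iota>" and "\<iota> 1 = 1"
    and "\<And>a b. \<iota> (a + b) = \<iota> a + \<iota> b" and "\<And>a b. \<iota> (a * b) = \<iota> a * \<iota> b"
    and "n \<ge> 1"
  shows "op_P n (mps_of_fps F) =
    (\<Sum>k=1..n. mps_of_fps ((fps_deriv ^^ k) F) * ballot_bell n k)"
proof -
  let ?P = "{\<pi>. partition_on {1..n} \<pi>}"
  let ?\<phi> = "\<lambda>\<pi>. mps_of_fps ((fps_deriv ^^ card \<pi>) F) * (\<Prod>B\<in>\<pi>. ballot_weight B)"
  have fin: "finite ?P" by (rule finitely_many_partition_on) simp
  \<comment> \<open>This makes grouping by k from 1 to \<open>n\<close> exhaustive:
    \<open>n \<ge> 1\<close> forces at least one block, and nonempty blocks number at most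
    \<open>n\<close>.\<close>
  have card: "card \<pi> \<in> {1..n}" if part: "partition_on {1..n} \<pi>" for \<pi>
  proof -
    have "finite \<pi>" using part by (rule finite_elements[rotated]) simp
    moreover have "\<pi> \<noteq> {}" using part \<open>n \<ge> 1\<close> by (auto simp: partition_on_def)
    moreover have "card \<pi> \<le> card {1..n}"
    proof -
      have fin: "finite B" if "B \<in> \<pi>" for B
        using part that by (metis Sup_upper finite_atLeastAtMost finite_subset partition_onD1)
      have "card \<pi> = (\<Sum>B\<in>\<pi>. 1)" by simp
      also have "\<dots> \<le> (\<Sum>B\<in>\<pi>. card B)"
        using part fin by (intro sum_mono) (metis One_nat_def Suc_leI card_gt_0_iff partition_onD3)
      also have "\<dots> = card {1..n}"
        using part fin by (rule product_partition[symmetric])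
      finally show ?thesis .
    qed
    ultimately show ?thesis by (simp add: Suc_le_eq card_gt_0_iff)
  qed
  have "op_P n (mps_of_fps F) = (\<Sum>\<pi>\<in>?P. ?\<phi> \<pi>)"
    by (rule op_P_mps_of_fps)
  also have "\<dots> = (\<Sum>k=1..n. \<Sum>\<pi> | \<pi> \<in> ?P \<and> card \<pi> = k. ?\<phi> \<pi>)"
    using fin card by (intro sum.group[symmetric]) auto
  also have "\<dots> = (\<Sum>k=1..n. mps_of_fps ((fps_deriv ^^ k) F) * ballot_bell n k)"
    by (intro sum.cong refl) (simp add: ballot_bell_eq sum_distrib_left)
  finally show ?thesis .
qed

end
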